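(* Let $\mathbf{d}$ be a distance on a set $X$ such that $X$ is $\mathbf{d}$-$\max$-continuous. Then $$\underline{\mathbf{d}^{\mathcal{H}}|_{\mathcal{P}^{\mathbf{d}}(X)}}=\mathbf{d}_{\mathcal{H}}|_{\mathcal{P}^{\mathbf{d}}(X)}.$$ Moreover, $\mathcal{P}^{\mathbf{d}}(X)$ is a $\mathbf{d}^{\mathcal{H}}$-$\max$-domain with $\mathbf{d}^{\mathcal{H}}$-$\max$-basis $\{(\leq^{\mathbf{d}}x):x\in X\}$, and for all $x,y\in X$, $$(\leq^{\mathbf{d}}x)\,\mathbf{d}^{\mathcal{H}}\,(\leq^{\mathbf{d}}y)\leq x\mathbf{d}y.$$
   Context: Suprema and infima are taken in $[0,\infty]$, with $\sup\emptyset=0$, $\inf\emptyset=\infty$; for $a,b\in[0,\infty]$, $(a-b)_+=\min\{c\in[0,\infty]:a\leq b+c\}$. A distance on $X$ is a function $\mathbf{d}:X\times X\to[0,\infty]$, written $x\mathbf{d}y$, with $x\mathbf{d}z\leq x\mathbf{d}y+y\mathbf{d}z$ for all $x,y,z$ (no symmetry, and $x\mathbf{d}x=0$ is not required). Functions are ordered pointwise. For any function $\mathbf{d}$ on $X\times X$, the upper and lower hemimetrics are $x\overline{\mathbf{d}}z=\sup_{y\in X}(x\mathbf{d}y-z\mathbf{d}y)_+$ and $z\underline{\mathbf{d}}y=\sup_{x\in X}(x\mathbf{d}y-x\mathbf{d}z)_+$; for a function restricted to a smaller set, the suprema range only over that smaller set. Write $(\leq^{\mathbf{d}}x)=\{y\in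 X:y\mathbf{d}x=0\}$. $Y\subseteq X$ is $\mathbf{d}$-directed if $\inf_{y\in Y}\sup_{z\in F}z\mathbf{d}y=0$ for every finite $F\subseteq Y$ (so $Y\neq\emptyset$); $\mathcal{P}^{\mathbf{d}}(X)$ is the set of $\mathbf{d}$-directed subsets of $X$. $x$ is a $\mathbf{d}$-maximum of $Y$ if $y\mathbf{d}x=0$ for all $y\in Y$ and $\inf_{y\in Y}z\mathbf{d}y\leq z\mathbf{d}x$ for all $z\in X$. $X$ is $\mathbf{d}$-$\max$-complete if every $\mathbf{d}$-directed subset of $X$ has a $\mathbf{d}$-maximum in $X$. $B\subseteq X$ is a $\mathbf{d}$-$\max$-basis of $X$ if every $x\in X$ is a $\mathbf{d}$-maximum of some $\mathbf{d}$-directed $Y\subseteq B$; $X$ is $\mathbf{d}$-$\max$-continuous if $X$ is a $\mathbf{d}$-$\max$-basis of itself. $X$ is a $\mathbf{d}$-$\max$-predomain if it is $\mathbf{d}$-$\max$-continuous and $\overline{\mathbf{d}}\leq\underline{\mathbf{d}}$; it is a $\mathbf{d}$-$\max$-domain if moreover it is $\mathbf{d}$-$\max$-complete. On the power set $\mathcal{P}(X)$ define $Y\mathbf{d}^{\mathcal{H}}Z=\inf_{z\in Z}\sup_{y\in Y}y\mathbf{d}z$ and $Y\mathbf{d}_{\mathcal{H}}Z=\sup_{y\in Y}\inf_{z\in Z}y\mathbf{d}z$; both are distances on $\mathcal{P}(X)$. The assertion that $\mathcal{P}^{\mathbf{d}}(X)$ is a $\mathbf{d}^{\mathcal{H}}$-$\max$-domain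 (with a given basis) refers to the set $\mathcal{P}^{\mathbf{d}}(X)$ with the restricted distance $\mathbf{d}^{\mathcal{H}}|_{\mathcal{P}^{\mathbf{d}}(X)}$. *)

theory Defs
  imports "HOL-Library.Extended_Nonnegative_Real"
begin

text \<open>
  A set \<open>X\<close> with a \<open>[0,\<infinity>]\<close>-valued function on \<open>X \<times> X\<close> is given by a carrier
  \<open>X :: 'a set\<close> and \<open>d :: 'a \<Rightarrow> 'a \<Rightarrow> ennreal\<close>. Every notion refers only to the values
  of \<open>d\<close> on the carrier, so restricting \<open>d\<close> to a subset means passing the smaller carrier.
  In \<open>ennreal\<close>, the supremum and infimum of the empty set are \<open>0\<close> and \<open>\<infinity>\<close>.
\<close>

type_synonym 'a dist = "'a \<Rightarrow> 'a \<Rightarrow> ennreal"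

definition distance_on :: "'a set \<Rightarrow> 'a dist \<Rightarrow> bool" where
  "distance_on X d \<longleftrightarrow> (\<forall>x\<in>X. \<forall>y\<in>X. \<forall>z\<in>X. d x z \<le> d x y + d y z)"

text \<open>
  The subtraction of \<open>ennreal\<close> cannot be used for \<open>(a - b)\<^sub>+\<close>: there \<open>\<infinity> - \<infinity> = \<infinity>\<close>,
  whereas \<open>(\<infinity> - \<infinity>)\<^sub>+ = 0\<close>. The infimum is a minimum, see \<open>pos_diff_attained\<close>.
\<close>

definition pos_diff :: "ennreal \<Rightarrow> ennreal \<Rightarrow> ennreal" where
  "pos_diff a b = Inf {c. a \<le> b + c}"

lemma pos_diff_attained: "a \<le> b + pos_diff a b"
proof (cases "b = top")
  case True
  then show ?thesis by simp
next
  case False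
  have "a - b \<le> pos_diff a b"
    unfolding pos_diff_def
    by (rule Inf_greatest) (auto simp: ennreal_minus_le_iff False)
  then show ?thesis
    using False by (simp add: ennreal_minus_le_iff)
qed

definition upper_hemimetric :: "'a set \<Rightarrow> 'a dist \<Rightarrow> 'a dist" where
  "upper_hemimetric X d x z = (SUP y\<in>X. pos_diff (d x y) (d z y))"

definition lower_hemimetric :: "'a set \<Rightarrow> 'a dist \<Rightarrow> 'a dist" where
  "lower_hemimetric X d z y = (SUP x\<in>X. pos_diff (d x y) (d x z))"

definition lower_set :: "'a set \<Rightarrow> 'a dist \<Rightarrow> 'a \<Rightarrow> 'a set" where
  "lower_set X d x = {y\<in>X. d y x = 0}"

text \<open>Taking \<open>F = {}\<close> shows that directed sets are nonempty.\<close>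

definition directed_set :: "'a dist \<Rightarrow> 'a set \<Rightarrow> bool" where
  "directed_set d Y \<longleftrightarrow> (\<forall>F. finite F \<and> F \<subseteq> Y \<longrightarrow> (INF y\<in>Y. SUP z\<in>F. d z y) = 0)"

definition directed_subsets :: "'a set \<Rightarrow> 'a dist \<Rightarrow> 'a set set" where
  "directed_subsets X d = {Y. Y \<subseteq> X \<and> directed_set d Y}"

definition is_maximum :: "'a set \<Rightarrow> 'a dist \<Rightarrow> 'a set \<Rightarrow> 'a \<Rightarrow> bool" where
  "is_maximum X d Y x \<longleftrightarrow>
     x \<in> X \<and> (\<forall>y\<in>Y. d y x = 0) \<and> (\<forall>z\<in>X. (INF y\<in>Y. d z y) \<le> d z x)"

definition max_complete :: "'a set \<Rightarrow> 'a dist \<Rightarrow> bool" where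
  "max_complete X d \<longleftrightarrow> (\<forall>Y\<in>directed_subsets X d. \<exists>x. is_maximum X d Y x)"

definition max_basis :: "'a set \<Rightarrow> 'a dist \<Rightarrow> 'a set \<Rightarrow> bool" where
  "max_basis X d B \<longleftrightarrow>
     B \<subseteq> X \<and> (\<forall>x\<in>X. \<exists>Y. Y \<subseteq> B \<and> directed_set d Y \<and> is_maximum X d Y x)"

definition max_continuous :: "'a set \<Rightarrow> 'a dist \<Rightarrow> bool" where
  "max_continuous X d \<longleftrightarrow> max_basis X d X"

definition max_predomain :: "'a set \<Rightarrow> 'a dist \<Rightarrow> bool" where
  "max_predomain X d \<longleftrightarrow> max_continuous X d \<and>
     (\<forall>x\<in>X. \<forall>y\<in>X. upper_hemimetric X d x y \<le> lower_hemimetric X d x y)"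

definition max_domain :: "'a set \<Rightarrow> 'a dist \<Rightarrow> bool" where
  "max_domain X d \<longleftrightarrow> max_predomain X d \<and> max_complete X d"

text \<open>\<open>dist_upper_H d\<close> is $d^{H}$ and \<open>dist_lower_H d\<close> is $d_{H}$.\<close>

definition dist_upper_H :: "'a dist \<Rightarrow> 'a set dist" where
  "dist_upper_H d Y Z = (INF z\<in>Z. SUP y\<in>Y. d y z)"

definition dist_lower_H :: "'a dist \<Rightarrow> 'a set dist" where
  "dist_lower_H d Y Z = (SUP y\<in>Y. INF z\<in>Z. d y z)"

lemma le_add_INF:
  fixes a c :: ennreal
  assumes "\<And>i. i \<in> I \<Longrightarrow> a \<le> c + f i"
  shows "a \<le> c + (INF i\<in>I. f i)"
proof (cases "c = top")
  case False
  have "a - c \<le> (INF i\<in>I. f i)"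
    using assms by (intro INF_greatest) (simp add: ennreal_minus_le_iff False)
  then show ?thesis
    using False by (simp add: ennreal_minus_le_iff)
qed simp

lemma distance_on_dist_upper_H:
  assumes "distance_on X d"
  shows "distance_on (Pow X) (dist_upper_H d)"
  unfolding distance_on_def
proof (intro ballI)
  fix U V W assume sub: "U \<in> Pow X" "V \<in> Pow X" "W \<in> Pow X"
  have step: "dist_upper_H d U W \<le> (SUP u\<in>U. d u v) + (SUP v\<in>V. d v w)"
    if "v \<in> V" "w \<in> W" for v w
    unfolding dist_upper_H_def
  proof (rule INF_lower2[OF that(2)], rule SUP_least)
    fix u assume "u \<in> U"
    then have "d u w \<le> d u v + d v w"
      using assms sub that unfolding distance_on_def by blast
    also have "\<dots> \<le> (SUP u\<in>U. d u v) + (SUP v\<in>V. d v w)"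
      by (intro add_mono SUP_upper \<open>u \<in> U\<close> that)
    finally show "d u w \<le> (SUP u\<in>U. d u v) + (SUP v\<in>V. d v w)" .
  qed
  show "dist_upper_H d U W \<le> dist_upper_H d U V + dist_upper_H d V W"
  proof -
    have "dist_upper_H d U W \<le> (SUP u\<in>U. d u v) + dist_upper_H d V W" if "v \<in> V" for v
      unfolding dist_upper_H_def[of d V W] by (intro le_add_INF step that)
    then have "dist_upper_H d U W \<le> dist_upper_H d V W + dist_upper_H d U V"
      unfolding dist_upper_H_def[of d U V] by (intro le_add_INF) (simp add: add.commute)
    then show ?thesis by (simp add: add.commute)
  qed
qed

end

theory Submission
  imports Defs
begin

text \<open>
  Write \<open>D\<close> for the directed subsets of \<open>X\<close>, \<open>d\<^sup>H\<close> and \<open>d\<^sub>H\<close> for the two Hausdorff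
  distances, and \<open>\<down>x\<close> for the lower set of \<open>x\<close>. Three ideas carry the theorem.

  \<^item> The distances satisfy the mixed triangle inequalities
    \<open>W d\<^sup>H Z \<le> W d\<^sup>H Y + Y d\<^sub>H Z\<close> and \<open>Y d\<^sup>H W \<le> Y d\<^sub>H Z + Z d\<^sup>H W\<close>
    (\<open>dist_upper_H_triangle_right\<close>, \<open>dist_upper_H_triangle_left\<close>). By the adjunction
    defining \<open>pos_diff\<close>, they say that \<open>d\<^sub>H\<close> lies above both the lower and the upper
    hemimetric of \<open>d\<^sup>H\<close>.

  \<^item> In a directed set \<open>Y\<close>, an approximation of each single point of a finite set \<open>F\<close>
    can be made simultaneous: \<open>INF y\<in>Y. SUP z\<in>F. d z y\<close> is bounded by
    \<open>SUP z\<in>F. INF y\<in>Y. d z y\<close> (\<open>directed_INF_SUP_le_SUP_INF\<close>). Hence lower sets of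
    maxima are directed, and so is the union of a \<open>d\<^sup>H\<close>-directed family of directed sets.
    That union is the required maximum, which makes \<open>D\<close> complete.

  \<^item> Max-continuity makes every \<open>x\<close> a maximum of the directed set \<open>\<down>x\<close>, so points can be
    replaced by their lower sets with arbitrarily small loss. A directed \<open>Y\<close> is therefore
    the maximum of \<open>{\<down>y | y. y \<in> Y}\<close>. The sets \<open>W = \<down>y\<close> with \<open>y \<in> Y\<close> have
    \<open>W d\<^sup>H Y = 0\<close>, and the supremum of their distances \<open>W d\<^sup>H Z\<close> is at least \<open>Y d\<^sub>H Z\<close>;
    this is why the lower hemimetric is not only below \<open>d\<^sub>H\<close> but equal to it, and
    then the upper hemimetric lies below the lower one.
\<close>

section \<open>Truncated difference and mixed triangle inequalities\<close>

lemma pos_diff_le_iff: "pos_diff a b \<le> c \<longleftrightarrow> a \<le> b + c"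
proof
  assume "pos_diff a b \<le> c"
  then show "a \<le> b + c"
    using pos_diff_attained[of a b] by (meson add_left_mono order_trans)
next
  assume "a \<le> b + c"
  then show "pos_diff a b \<le> c"
    unfolding pos_diff_def by (intro Inf_lower) simp
qed

lemma dist_lower_H_le_dist_upper_H: "dist_lower_H d Y Z \<le> dist_upper_H d Y Z"
  unfolding dist_lower_H_def dist_upper_H_def
proof (intro SUP_least INF_greatest)
  fix y z assume "y \<in> Y" "z \<in> Z"
  then have "(INF z\<in>Z. d y z) \<le> d y z" "d y z \<le> (SUP y\<in>Y. d y z)"
    by (auto intro: INF_lower SUP_upper)
  then show "(INF z\<in>Z. d y z) \<le> (SUP y\<in>Y. d y z)" by (rule order_trans)
qed

lemma dist_upper_H_triangle_right:
  assumes d: "distance_on X d" and sub: "W \<subseteq> X" "Y \<subseteq> X" "Z \<subseteq> X"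
  shows "dist_upper_H d W Z \<le> dist_upper_H d W Y + dist_lower_H d Y Z"
proof -
  have "dist_upper_H d W Z \<le> dist_lower_H d Y Z + (SUP w\<in>W. d w y)" if y: "y \<in> Y" for y
  proof -
    have "dist_upper_H d W Z \<le> (SUP w\<in>W. d w y) + d y z" if z: "z \<in> Z" for z
      unfolding dist_upper_H_def
    proof (intro INF_lower2[OF z] SUP_least)
      fix w assume w: "w \<in> W"
      have "d w z \<le> d w y + d y z"
        using d sub w y z unfolding distance_on_def by blast
      also have "\<dots> \<le> (SUP w\<in>W. d w y) + d y z"
        by (intro add_right_mono SUP_upper w)
      finally show "d w z \<le> (SUP w\<in>W. d w y) + d y z" .
    qed
    then have "dist_upper_H d W Z \<le> (SUP w\<in>W. d w y) + (INF z\<in>Z. d y z)"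
      by (rule le_add_INF)
    also have "\<dots> \<le> (SUP w\<in>W. d w y) + dist_lower_H d Y Z"
      unfolding dist_lower_H_def by (intro add_left_mono SUP_upper y)
    finally show ?thesis by (simp add: add.commute)
  qed
  then have "dist_upper_H d W Z \<le> dist_lower_H d Y Z + dist_upper_H d W Y"
    unfolding dist_upper_H_def[of d W Y] by (rule le_add_INF)
  then show ?thesis by (simp add: add.commute)
qed

lemma dist_upper_H_triangle_left:
  assumes d: "distance_on X d" and sub: "Y \<subseteq> X" "Z \<subseteq> X" "W \<subseteq> X"
  shows "dist_upper_H d Y W \<le> dist_lower_H d Y Z + dist_upper_H d Z W"
proof -
  have "dist_upper_H d Y W \<le> dist_lower_H d Y Z + (SUP z\<in>Z. d z w)" if w: "w \<in> W" for w
    unfolding dist_upper_H_def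
  proof (intro INF_lower2[OF w] SUP_least)
    fix y assume y: "y \<in> Y"
    have "d y w \<le> (SUP z\<in>Z. d z w) + d y z" if z: "z \<in> Z" for z
    proof -
      have "d y w \<le> d z w + d y z"
        using d sub w y z unfolding distance_on_def by (metis add.commute subsetD)
      also have "\<dots> \<le> (SUP z\<in>Z. d z w) + d y z"
        by (intro add_right_mono SUP_upper z)
      finally show ?thesis .
    qed
    then have "d y w \<le> (SUP z\<in>Z. d z w) + (INF z\<in>Z. d y z)"
      by (rule le_add_INF)
    also have "\<dots> \<le> (SUP z\<in>Z. d z w) + dist_lower_H d Y Z"
      unfolding dist_lower_H_def by (intro add_left_mono SUP_upper y)
    finally show "d y w \<le> dist_lower_H d Y Z + (SUP z\<in>Z. d z w)"
      by (simp add: add.commute)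
  qed
  then show ?thesis
    unfolding dist_upper_H_def[of d Z W] by (rule le_add_INF)
qed

section \<open>Directed sets and their unions\<close>

lemma directed_INF_eq_0:
  assumes "directed_set d Y" "y \<in> Y"
  shows "(INF z\<in>Y. d y z) = 0"
proof -
  have "finite {y} \<and> {y} \<subseteq> Y" using assms by simp
  then have "(INF z\<in>Y. SUP u\<in>{y}. d u z) = 0"
    using assms(1) unfolding directed_set_def by blast
  then show ?thesis by simp
qed

text \<open>
  Approximate each \<open>z \<in> F\<close> by its own point of \<open>Y\<close>; the finitely many points chosen lie
  almost below one point of \<open>Y\<close>, by directedness. The reverse inequality holds for
  arbitrary sets.
\<close>

lemma directed_INF_SUP_le_SUP_INF:
  assumes d: "distance_on X d" and dir: "directed_set d Y" and sub: "Y \<subseteq> X"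
    and F: "finite F" "F \<subseteq> X"
  shows "(INF y\<in>Y. SUP z\<in>F. d z y) \<le> (SUP z\<in>F. INF y\<in>Y. d z y)" (is "_ \<le> ?s")
proof (rule ennreal_le_epsilon)
  fix e :: real assume fin: "?s < top" and e: "0 < e"
  define h where "h = ennreal (e / 2)"
  have h: "0 < h" "h + h = ennreal e"
    using e by (simp_all add: h_def ennreal_plus[symmetric] del: ennreal_plus)
  have "\<exists>y\<in>Y. d z y < ?s + h" if z: "z \<in> F" for z
  proof -
    have "(INF y\<in>Y. d z y) \<le> ?s" by (intro SUP_upper z)
    also have "?s < ?s + h"
      using fin h(1) by (metis add.right_neutral ennreal_add_left_cancel_less infinity_ennreal_def less_top)
    finally show ?thesis by (simp add: INF_less_iff)
  qed
  then obtain g where g: "\<And>z. z \<in> F \<Longrightarrow> g z \<in> Y" "\<And>z. z \<in> F \<Longrightarrow> d z (g z) < ?s + h"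
    by metis
  have "finite (g ` F) \<and> g ` F \<subseteq> Y" using F g by blast
  then have "(INF y\<in>Y. SUP u\<in>g ` F. d u y) < h"
    using dir h(1) unfolding directed_set_def by metis
  then obtain y where y: "y \<in> Y" "(SUP u\<in>g ` F. d u y) < h"
    by (auto simp: INF_less_iff)
  show "(INF y\<in>Y. SUP z\<in>F. d z y) \<le> ?s + ennreal e"
  proof (intro INF_lower2[OF y(1)] SUP_least)
    fix z assume z: "z \<in> F"
    have "d z y \<le> d z (g z) + d (g z) y"
      using d sub F z g y unfolding distance_on_def by blast
    also have "\<dots> \<le> (?s + h) + (SUP u\<in>g ` F. d u y)"
      by (intro add_mono less_imp_le[OF g(2)] SUP_upper z imageI)
    also have "\<dots> \<le> (?s + h) + h" using y(2) by (intro add_left_mono) simp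
    finally show "d z y \<le> ?s + ennreal e" by (simp add: add.assoc h(2))
  qed
qed

text \<open>
  A finite subset of the union meets finitely many members of the family, and these are all
  approximated by one member \<open>Z\<close>; inside the directed set \<open>Z\<close>, the approximating points are
  merged into one.
\<close>

lemma directed_Union:
  assumes d: "distance_on X d" and sub: "\<Y> \<subseteq> directed_subsets X d"
    and dir: "directed_set (dist_upper_H d) \<Y>"
  shows "directed_set d (\<Union>\<Y>)"
  unfolding directed_set_def
proof (intro allI impI)
  fix F assume F: "finite F \<and> F \<subseteq> \<Union>\<Y>"
  then have "\<forall>y\<in>F. \<exists>Y. Y \<in> \<Y> \<and> y \<in> Y" by blast
  from bchoice[OF this] obtain g
    where g: "\<And>y. y \<in> F \<Longrightarrow> g y \<in> \<Y>" "\<And>y. y \<in> F \<Longrightarrow> y \<in> g y"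
    by blast
  have FX: "F \<subseteq> X" using F sub unfolding directed_subsets_def by blast
  have "(INF u\<in>\<Union>\<Y>. SUP y\<in>F. d y u) \<le> (SUP Y\<in>g ` F. dist_upper_H d Y Z)"
    if Z: "Z \<in> \<Y>" for Z
  proof -
    have "(INF u\<in>\<Union>\<Y>. SUP y\<in>F. d y u) \<le> (INF z\<in>Z. SUP y\<in>F. d y z)"
      using Z by (intro INF_superset_mono) auto
    also have "\<dots> \<le> (SUP y\<in>F. INF z\<in>Z. d y z)"
      using sub Z F FX by (intro directed_INF_SUP_le_SUP_INF[OF d]) (auto simp: directed_subsets_def)
    also have "\<dots> \<le> (SUP Y\<in>g ` F. dist_upper_H d Y Z)"
    proof (rule SUP_least)
      fix y assume y: "y \<in> F"
      have "(INF z\<in>Z. d y z) \<le> dist_lower_H d (g y) Z"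
        unfolding dist_lower_H_def by (intro SUP_upper g y)
      also have "\<dots> \<le> dist_upper_H d (g y) Z" by (rule dist_lower_H_le_dist_upper_H)
      also have "\<dots> \<le> (SUP Y\<in>g ` F. dist_upper_H d Y Z)"
        by (intro SUP_upper imageI y)
      finally show "(INF z\<in>Z. d y z) \<le> (SUP Y\<in>g ` F. dist_upper_H d Y Z)" .
    qed
    finally show ?thesis .
  qed
  then have "(INF u\<in>\<Union>\<Y>. SUP y\<in>F. d y u) \<le> (INF Z\<in>\<Y>. SUP Y\<in>g ` F. dist_upper_H d Y Z)"
    by (rule INF_greatest)
  moreover have "finite (g ` F) \<and> g ` F \<subseteq> \<Y>" using F g by blast
  ultimately show "(INF u\<in>\<Union>\<Y>. SUP y\<in>F. d y u) = 0"
    using dir unfolding directed_set_def by (metis le_zero_eq)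
qed

text \<open>
  The infimum over the union defining \<open>W d\<^sup>H \<Union>\<Y>\<close> is the infimum of the \<open>W d\<^sup>H Y\<close> over
  \<open>Y \<in> \<Y>\<close>. So the second condition on a maximum is an equality, and the first one holds
  because every \<open>Y\<close> is approximated by members of \<open>\<Y>\<close>.
\<close>

lemma max_complete_directed_subsets:
  assumes d: "distance_on X d"
  shows "max_complete (directed_subsets X d) (dist_upper_H d)"
  unfolding max_complete_def
proof
  fix \<Y> assume "\<Y> \<in> directed_subsets (directed_subsets X d) (dist_upper_H d)"
  then have sub: "\<Y> \<subseteq> directed_subsets X d" and dir: "directed_set (dist_upper_H d) \<Y>"
    by (auto simp: directed_subsets_def)
  have U: "\<Union>\<Y> \<in> directed_subsets X d"
    using directed_Union[OF d sub dir] sub unfolding directed_subsets_def by blast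
  have eq: "dist_upper_H d W (\<Union>\<Y>) = (INF Y\<in>\<Y>. dist_upper_H d W Y)" for W
    unfolding dist_upper_H_def
  proof (rule antisym)
    show "(INF u\<in>\<Union>\<Y>. SUP w\<in>W. d w u) \<le> (INF Y\<in>\<Y>. INF u\<in>Y. SUP w\<in>W. d w u)"
      by (intro INF_greatest INF_lower) blast
    show "(INF Y\<in>\<Y>. INF u\<in>Y. SUP w\<in>W. d w u) \<le> (INF u\<in>\<Union>\<Y>. SUP w\<in>W. d w u)"
    proof (rule INF_greatest)
      fix u assume "u \<in> \<Union>\<Y>"
      then obtain Y where "Y \<in> \<Y>" "u \<in> Y" by blast
      then show "(INF Y\<in>\<Y>. INF u\<in>Y. SUP w\<in>W. d w u) \<le> (SUP w\<in>W. d w u)"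
        by (intro INF_lower2[of Y \<Y>] INF_lower)
    qed
  qed
  have "is_maximum (directed_subsets X d) (dist_upper_H d) \<Y> (\<Union>\<Y>)"
    unfolding is_maximum_def using U dir by (simp add: eq directed_INF_eq_0)
  then show "\<exists>U. is_maximum (directed_subsets X d) (dist_upper_H d) \<Y> U" ..
qed

section \<open>Lower sets in a max-continuous space\<close>

text \<open>
  A directed set with maximum \<open>x\<close> is contained in the lower set of \<open>x\<close> and already
  approximates it, so both directedness and the maximum pass to the lower set.
\<close>

lemma lower_set_of_maximum:
  assumes d: "distance_on X d" and dir: "directed_set d Y" and sub: "Y \<subseteq> X"
    and max: "is_maximum X d Y x"
  shows "lower_set X d x \<in> directed_subsets X d" and "is_maximum X d (lower_set X d x) x"
proof -
  have x: "x \<in> X" and Y: "Y \<subseteq> lower_set X d x"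
    and le: "\<And>z. z \<in> X \<Longrightarrow> (INF y\<in>Y. d z y) \<le> d z x"
    using max sub by (auto simp: is_maximum_def lower_set_def)
  have "(INF y\<in>lower_set X d x. SUP z\<in>F. d z y) = 0"
    if F: "finite F \<and> F \<subseteq> lower_set X d x" for F
  proof -
    have FX: "F \<subseteq> X" and F0: "\<And>z. z \<in> F \<Longrightarrow> d z x = 0" using F by (auto simp: lower_set_def)
    have "(INF y\<in>lower_set X d x. SUP z\<in>F. d z y) \<le> (INF y\<in>Y. SUP z\<in>F. d z y)"
      by (intro INF_superset_mono Y) simp
    also have "\<dots> \<le> (SUP z\<in>F. INF y\<in>Y. d z y)"
      using F FX by (intro directed_INF_SUP_le_SUP_INF[OF d dir sub]) auto
    also have "\<dots> \<le> 0"
    proof (rule SUP_least)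
      fix z assume z: "z \<in> F"
      then have "(INF y\<in>Y. d z y) \<le> d z x" using FX by (intro le) blast
      then show "(INF y\<in>Y. d z y) \<le> 0" using F0[OF z] by simp
    qed
    finally show ?thesis by simp
  qed
  then show "lower_set X d x \<in> directed_subsets X d"
    by (auto simp: directed_subsets_def directed_set_def lower_set_def)
  have "(INF y\<in>lower_set X d x. d z y) \<le> d z x" if "z \<in> X" for z
    using INF_superset_mono[OF Y, of "d z" "d z"] le[OF that] by (auto intro: order_trans)
  then show "is_maximum X d (lower_set X d x) x"
    using x by (simp add: is_maximum_def lower_set_def)
qed

lemma max_continuous_lower_set:
  assumes "distance_on X d" "max_continuous X d" "x \<in> X"
  shows "lower_set X d x \<in> directed_subsets X d" and "is_maximum X d (lower_set X d x) x"
  using assms lower_set_of_maximum unfolding max_continuous_def max_basis_def by metis+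

lemma dist_upper_H_lower_set_eq_0:
  assumes "y \<in> Y"
  shows "dist_upper_H d (lower_set X d y) Y = 0"
proof -
  have "dist_upper_H d (lower_set X d y) Y \<le> (SUP w\<in>lower_set X d y. d w y)"
    unfolding dist_upper_H_def by (rule INF_lower[OF assms])
  also have "\<dots> \<le> 0" by (rule SUP_least) (simp add: lower_set_def)
  finally show ?thesis by simp
qed

text \<open>Passing from \<open>v\<close> to the lower set of \<open>y\<close> costs at most \<open>d v y\<close>, as \<open>y\<close> is its maximum.\<close>

lemma dist_upper_H_lower_set_le:
  assumes d: "distance_on X d" and c: "max_continuous X d"
    and W: "W \<subseteq> X" and v: "v \<in> X" and y: "y \<in> X"
  shows "dist_upper_H d W (lower_set X d y) \<le> (SUP w\<in>W. d w v) + d v y"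
proof -
  have "dist_upper_H d W (lower_set X d y)
        \<le> dist_upper_H d W {v} + dist_lower_H d {v} (lower_set X d y)"
    using W v by (intro dist_upper_H_triangle_right[OF d]) (auto simp: lower_set_def)
  also have "\<dots> = (SUP w\<in>W. d w v) + (INF u\<in>lower_set X d y. d v u)"
    by (simp add: dist_upper_H_def dist_lower_H_def)
  also have "\<dots> \<le> (SUP w\<in>W. d w v) + d v y"
    using max_continuous_lower_set(2)[OF d c y] v
    by (intro add_left_mono) (simp add: is_maximum_def)
  finally show ?thesis .
qed

lemma dist_upper_H_lower_sets_le:
  assumes "distance_on X d" "max_continuous X d" "x \<in> X" "y \<in> X"
  shows "dist_upper_H d (lower_set X d x) (lower_set X d y) \<le> d x y"
proof -
  have "(SUP w\<in>lower_set X d x. d w x) \<le> 0"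
    by (rule SUP_least) (simp add: lower_set_def)
  moreover have "dist_upper_H d (lower_set X d x) (lower_set X d y)
      \<le> (SUP w\<in>lower_set X d x. d w x) + d x y"
    using assms by (intro dist_upper_H_lower_set_le) (auto simp: lower_set_def)
  ultimately show ?thesis by simp
qed

section \<open>The domain of directed subsets\<close>

text \<open>
  One inequality is a mixed triangle inequality. For the other, the lower hemimetric is
  tested against lower sets of points of \<open>Y\<close>. Since \<open>d y y = 0\<close> may fail, \<open>y\<close> need not be
  approximated from its own lower set, but it is so from that of a suitable \<open>y' \<in> Y\<close>.
\<close>

lemma lower_hemimetric_dist_upper_H:
  assumes d: "distance_on X d" and c: "max_continuous X d"
    and Y: "Y \<in> directed_subsets X d" and Z: "Z \<in> directed_subsets X d"
  shows "lower_hemimetric (directed_subsets X d) (dist_upper_H d) Y Z = dist_lower_H d Y Z"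
    (is "?l = _")
proof (rule antisym)
  show "?l \<le> dist_lower_H d Y Z"
    unfolding lower_hemimetric_def
    using Y Z by (intro SUP_least)
      (auto simp: pos_diff_le_iff directed_subsets_def intro: dist_upper_H_triangle_right[OF d])
next
  have YX: "Y \<subseteq> X" and Ydir: "directed_set d Y" and ZX: "Z \<subseteq> X"
    using Y Z by (auto simp: directed_subsets_def)
  show "dist_lower_H d Y Z \<le> ?l"
    unfolding dist_lower_H_def
  proof (rule SUP_least)
    fix y assume y: "y \<in> Y"
    have "(INF z\<in>Z. d y z) \<le> ?l + d y y'" if y': "y' \<in> Y" for y'
    proof -
      let ?W = "lower_set X d y'"
      have W: "?W \<in> directed_subsets X d" "(INF w\<in>?W. d y w) \<le> d y y'"
        using max_continuous_lower_set[OF d c, of y'] y y' YX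
        by (auto simp: is_maximum_def)
      have "(INF z\<in>Z. d y z) = dist_upper_H d {y} Z"
        by (simp add: dist_upper_H_def)
      also have "\<dots> \<le> dist_lower_H d {y} ?W + dist_upper_H d ?W Z"
        using y YX ZX by (intro dist_upper_H_triangle_left[OF d]) (auto simp: lower_set_def)
      also have "\<dots> \<le> d y y' + ?l"
      proof (rule add_mono)
        show "dist_lower_H d {y} ?W \<le> d y y'" using W(2) by (simp add: dist_lower_H_def)
        have "pos_diff (dist_upper_H d ?W Z) (dist_upper_H d ?W Y) \<le> ?l"
          unfolding lower_hemimetric_def by (rule SUP_upper[OF W(1)])
        then show "dist_upper_H d ?W Z \<le> ?l"
          by (simp add: pos_diff_le_iff dist_upper_H_lower_set_eq_0[OF y'])
      qed
      finally show ?thesis by (simp add: add.commute)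
    qed
    then have "(INF z\<in>Z. d y z) \<le> ?l + (INF y'\<in>Y. d y y')" by (rule le_add_INF)
    then show "(INF z\<in>Z. d y z) \<le> ?l" by (simp add: directed_INF_eq_0[OF Ydir y])
  qed
qed

lemma upper_hemimetric_dist_upper_H_le:
  assumes "distance_on X d" "Y \<in> directed_subsets X d" "Z \<in> directed_subsets X d"
  shows "upper_hemimetric (directed_subsets X d) (dist_upper_H d) Y Z \<le> dist_lower_H d Y Z"
  unfolding upper_hemimetric_def
proof (rule SUP_least)
  fix W assume "W \<in> directed_subsets X d"
  then have "dist_upper_H d Y W \<le> dist_lower_H d Y Z + dist_upper_H d Z W"
    using assms by (intro dist_upper_H_triangle_left) (auto simp: directed_subsets_def)
  then show "pos_diff (dist_upper_H d Y W) (dist_upper_H d Z W) \<le> dist_lower_H d Y Z"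
    by (simp add: pos_diff_le_iff add.commute)
qed

text \<open>
  A directed set \<open>Y\<close> is the maximum of the lower sets of its points: these inherit
  directedness from \<open>Y\<close> because passing to lower sets does not increase distances.
\<close>

lemma max_basis_lower_sets:
  assumes d: "distance_on X d" and c: "max_continuous X d"
  shows "max_basis (directed_subsets X d) (dist_upper_H d) (lower_set X d ` X)"
  unfolding max_basis_def
proof (intro conjI ballI)
  show "lower_set X d ` X \<subseteq> directed_subsets X d"
    using max_continuous_lower_set(1)[OF d c] by blast
next
  fix Y assume Y: "Y \<in> directed_subsets X d"
  then have YX: "Y \<subseteq> X" and Ydir: "directed_set d Y" by (auto simp: directed_subsets_def)
  let ?B = "lower_set X d ` Y"
  have "directed_set (dist_upper_H d) ?B"
    unfolding directed_set_def
  proof (intro allI impI)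
    fix \<F> assume "finite \<F> \<and> \<F> \<subseteq> ?B"
    then obtain F where F: "finite F" "F \<subseteq> Y" "\<F> = lower_set X d ` F"
      by (metis finite_subset_image)
    have "(INF V\<in>?B. SUP U\<in>\<F>. dist_upper_H d U V)
        = (INF y\<in>Y. SUP z\<in>F. dist_upper_H d (lower_set X d z) (lower_set X d y))"
      by (simp add: F(3) image_image)
    also have "\<dots> \<le> (INF y\<in>Y. SUP z\<in>F. d z y)"
    proof (intro INF_superset_mono[OF order_refl] SUP_subset_mono[OF order_refl])
      fix y z assume "y \<in> Y" "z \<in> F"
      then show "dist_upper_H d (lower_set X d z) (lower_set X d y) \<le> d z y"
        using F(2) YX by (intro dist_upper_H_lower_sets_le[OF d c]) auto
    qed
    also have "\<dots> = 0" using Ydir F unfolding directed_set_def by blast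
    finally show "(INF V\<in>?B. SUP U\<in>\<F>. dist_upper_H d U V) = 0" by simp
  qed
  moreover have "is_maximum (directed_subsets X d) (dist_upper_H d) ?B Y"
    unfolding is_maximum_def
  proof (intro conjI ballI Y)
    fix V assume "V \<in> ?B"
    then show "dist_upper_H d V Y = 0" by (auto simp: dist_upper_H_lower_set_eq_0)
  next
    fix W assume "W \<in> directed_subsets X d"
    then have WX: "W \<subseteq> X" by (simp add: directed_subsets_def)
    have "(INF V\<in>?B. dist_upper_H d W V) \<le> (SUP w\<in>W. d w v)" if v: "v \<in> Y" for v
    proof -
      have "(INF V\<in>?B. dist_upper_H d W V) \<le> (SUP w\<in>W. d w v) + d v y" if y: "y \<in> Y" for y
        using YX v y
        by (intro INF_lower2[OF imageI[OF y]] dist_upper_H_lower_set_le[OF d c WX]) auto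
      then have "(INF V\<in>?B. dist_upper_H d W V) \<le> (SUP w\<in>W. d w v) + (INF y\<in>Y. d v y)"
        by (rule le_add_INF)
      then show ?thesis by (simp add: directed_INF_eq_0[OF Ydir v])
    qed
    then show "(INF V\<in>?B. dist_upper_H d W V) \<le> dist_upper_H d W Y"
      unfolding dist_upper_H_def[of d W Y] by (rule INF_greatest)
  qed
  ultimately show "\<exists>\<B>. \<B> \<subseteq> lower_set X d ` X \<and> directed_set (dist_upper_H d) \<B>
      \<and> is_maximum (directed_subsets X d) (dist_upper_H d) \<B> Y"
    using YX by (intro exI[of _ ?B]) auto
qed

lemma max_basis_imp_max_continuous: "max_basis X d B \<Longrightarrow> max_continuous X d"
  unfolding max_continuous_def max_basis_def by (meson order_refl order_trans)

theorem theorem4p7: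
  fixes X :: "'a set" and d :: "'a \<Rightarrow> 'a \<Rightarrow> ennreal"
  assumes "distance_on X d"
    and "max_continuous X d"
  shows "(\<forall>Y\<in>directed_subsets X d. \<forall>Z\<in>directed_subsets X d.
            lower_hemimetric (directed_subsets X d) (dist_upper_H d) Y Z = dist_lower_H d Y Z)
       \<and> max_domain (directed_subsets X d) (dist_upper_H d)
       \<and> max_basis (directed_subsets X d) (dist_upper_H d) (lower_set X d ` X)
       \<and> (\<forall>x\<in>X. \<forall>y\<in>X. dist_upper_H d (lower_set X d x) (lower_set X d y) \<le> d x y)"
proof -
  note lower = lower_hemimetric_dist_upper_H[OF assms]
  note basis = max_basis_lower_sets[OF assms]
  have "max_domain (directed_subsets X d) (dist_upper_H d)"
    unfolding max_domain_def max_predomain_def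
    using max_basis_imp_max_continuous[OF basis] max_complete_directed_subsets[OF assms(1)]
      upper_hemimetric_dist_upper_H_le[OF assms(1)]
    by (simp add: lower)
  then show ?thesis
    using lower basis dist_upper_H_lower_sets_le[OF assms] by blast
qed

end
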